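(* For every $p\in[0,1]$, the function $g_p$ given by $$g_p(t)=\frac{1}{t^2}\log\left[p\,e^{t(1-p)}+(1-p)\,e^{-tp}\right],\quad t\in\mathbb{R},$$ is strictly unimodal.
   Context: A differentiable function $f:\mathbb{R}\to\mathbb{R}$ is called strictly unimodal if there exists $x\in\mathbb{R}$ such that the derivative $f'$ is positive on $(-\infty,x)$ and negative on $(x,\infty)$. The value of $g_p$ at $t=0$ is understood by continuous extension.
   Formalization: The formal statement takes p in the open interval (0,1) instead of [0,1]: for p = 0 and p = 1 the function g_p is identically zero, so its derivative is never positive and g_p is not strictly unimodal. *)

theory Defs
  imports "HOL-Analysis.Analysis"
begin

definition strictly_unimodal :: "(real \<Rightarrow> real) \<Rightarrow> bool" where
  "strictly_unimodal f \<longleftrightarrow>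
     f differentiable_on UNIV \<and>
     (\<exists>x. (\<forall>t<x. deriv f t > 0) \<and> (\<forall>t>x. deriv f t < 0))"

definition g_formula :: "real \<Rightarrow> real \<Rightarrow> real" where
  "g_formula p t = (1 / t\<^sup>2) * ln (p * exp (t * (1 - p)) + (1 - p) * exp (- t * p))"

text \<open>The value at \<open>t = 0\<close> is the limit, i.e. the continuous extension
  (the bare formula would give \<open>0\<close> there, because \<open>1 / 0 = 0\<close>).\<close>

definition g :: "real \<Rightarrow> real \<Rightarrow> real" where
  "g p t = (if t = 0 then Lim (at 0) (g_formula p) else g_formula p t)"

text \<open>For \<open>p = 0\<close> and \<open>p = 1\<close> the function is identically zero, hence not strictly
  unimodal; the theorem can only hold for \<open>0 < p < 1\<close>.\<close>

lemma g_endpoints: "g 0 = (\<lambda>t. 0)" "g 1 = (\<lambda>t. 0)"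
proof -
  have "g_formula 0 = (\<lambda>t. 0)" "g_formula 1 = (\<lambda>t. 0)"
    by (auto simp: g_formula_def)
  moreover have "Lim (at 0) (\<lambda>t::real. 0::real) = 0"
    by (rule tendsto_Lim) auto
  ultimately show "g 0 = (\<lambda>t. 0)" "g 1 = (\<lambda>t. 0)"
    by (auto simp: g_def)
qed

lemma not_strictly_unimodal_endpoints:
  "\<not> strictly_unimodal (g 0)" "\<not> strictly_unimodal (g 1)"
proof -
  have "\<not> strictly_unimodal (\<lambda>t. 0)"
    unfolding strictly_unimodal_def by (auto intro: gt_ex)
  then show "\<not> strictly_unimodal (g 0)" "\<not> strictly_unimodal (g 1)"
    by (simp_all add: g_endpoints)
qed

end

theory Submission
  imports Defs
begin

text \<open>
  Let \<open>L\<close> be the logarithm in the definition of \<open>g p\<close>, so that \<open>L' = s - p\<close> for the logistic function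
  \<open>s t = p * exp t / (1 - p + p * exp t)\<close> and \<open>s' = s * (1 - s)\<close>. The derivative of \<open>L t / t\<^sup>2\<close> is \<open>h t / t ^ 3\<close>
  with \<open>h t = t * L' t - 2 * L t\<close>, and \<open>h 0 = h' 0 = 0\<close>, \<open>h'' t = t * s t * (1 - s t) * (1 - 2 * s t)\<close>.
  By the symmetry \<open>g p t = g (1 - p) (- t)\<close> take \<open>p \<le> 1/2\<close> and put \<open>c = ln ((1 - p) / p) \<ge> 0\<close>, the
  point where \<open>s = 1/2\<close>. Then \<open>h\<close> is negative on the negative axis, positive on \<open>(0, c]\<close>
  and strictly concave on \<open>[c, \<infinity>)\<close>; since \<open>h (2 * c) = 0\<close>, its only further change of sign is at
  \<open>2 * c\<close>, which is therefore the mode.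
\<close>

section \<open>General facts on differentiable real functions\<close>

text \<open>Mean value theorem on the two sides of a point: a nonpositive value inside
  \<open>(a, b)\<close> would need a negative slope before it and a nonnegative slope after it,
  against the strict decrease of \<open>f'\<close>. The descent from \<open>a\<close> to
  \<open>b\<close> has a negative slope somewhere, and beyond \<open>b\<close> all slopes lie below
  that one.\<close>

lemma strict_antimono_deriv_sign:
  fixes f f' :: "real \<Rightarrow> real"
  assumes f: "\<And>t. (f has_real_derivative f' t) (at t)"
    and f': "\<And>u v. a \<le> u \<Longrightarrow> u < v \<Longrightarrow> f' v < f' u"
    and "a < b" "0 < f a" "f b = 0"
  shows "a < t \<Longrightarrow> t < b \<Longrightarrow> 0 < f t" and "b < t \<Longrightarrow> f t < 0"
proof -
  have mvt: "\<exists>z>x. z < y \<and> f y - f x = (y - x) * f' z" if "x < y" for x y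
    using MVT2[OF that f] by blast
  show "0 < f t" if t: "a < t" "t < b"
  proof (rule ccontr)
    assume neg: "\<not> 0 < f t"
    obtain y where y: "a < y" "y < t" "f t - f a = (t - a) * f' y" using mvt[OF t(1)] by blast
    obtain z where z: "t < z" "z < b" "f b - f t = (b - t) * f' z" using mvt[OF t(2)] by blast
    have "(t - a) * f' y < 0" using y neg assms by linarith
    then have "f' y < 0" using t by (simp add: mult_less_0_iff)
    moreover have "(b - t) * f' z \<ge> 0" using z neg assms by linarith
    then have "f' z \<ge> 0" using t by (simp add: zero_le_mult_iff)
    moreover have "f' z < f' y" using y z by (intro f') auto
    ultimately show False by linarith
  qed
  show "f t < 0" if t: "b < t"
  proof -
    obtain y where y: "a < y" "y < b" "f b - f a = (b - a) * f' y" using mvt[OF \<open>a < b\<close>] by blast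
    obtain z where z: "b < z" "z < t" "f t - f b = (t - b) * f' z" using mvt[OF t] by blast
    have "(b - a) * f' y < 0" using y assms by linarith
    then have "f' y < 0" using \<open>a < b\<close> by (simp add: mult_less_0_iff)
    moreover have "f' z < f' y" using y z by (intro f') auto
    ultimately have "(t - b) * f' z < 0" using t by (intro mult_pos_neg) auto
    then show "f t < 0" using z assms by simp
  qed
qed

text \<open>With derivatives given everywhere, the rule chains: its conclusion has the shape of its
  premise \<open>lim\<close>, which serves for the expansions at \<open>0\<close> below.\<close>

lemma lhopital_at_0_real:
  fixes f g :: "real \<Rightarrow> real"
  assumes f: "\<And>t. (f has_real_derivative f' t) (at t)" "f 0 = 0"
    and g: "\<And>t. (g has_real_derivative g' t) (at t)" "g 0 = 0"
    and nz: "\<And>t. t \<noteq> 0 \<Longrightarrow> g t \<noteq> 0" "\<And>t. t \<noteq> 0 \<Longrightarrow> g' t \<noteq> 0"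
    and lim: "((\<lambda>t. f' t / g' t) \<longlongrightarrow> l) (at 0)"
  shows "((\<lambda>t. f t / g t) \<longlongrightarrow> l) (at 0)"
proof (rule lhopital[OF _ _ _ _ _ _ lim])
  show "(f \<longlongrightarrow> 0) (at 0)" "(g \<longlongrightarrow> 0) (at 0)"
    using DERIV_isCont[OF f(1)[of 0]] DERIV_isCont[OF g(1)[of 0]] f(2) g(2)
    by (simp_all add: isCont_def)
qed (use f g nz in \<open>simp_all add: eventually_at_filter\<close>)

text \<open>Reflection exchanges the two half-lines and also flips the sign of the derivative, so
  the mode \<open>x\<close> moves to \<open>- x\<close>.\<close>

lemma strictly_unimodal_reflect:
  assumes "strictly_unimodal f"
  shows "strictly_unimodal (\<lambda>t. f (- t))"
proof -
  obtain x where diff: "f differentiable_on UNIV"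
    and x: "\<forall>t<x. deriv f t > 0" "\<forall>t>x. deriv f t < 0"
    using assms by (auto simp: strictly_unimodal_def)
  have D: "((\<lambda>t. f (- t)) has_real_derivative - deriv f (- t)) (at t)" for t
  proof -
    have "f field_differentiable at (- t)"
      using diff by (simp add: differentiable_on_def field_differentiable_def
          real_differentiable_def)
    then have "(f has_real_derivative deriv f (- t)) (at (- t))"
      by (simp add: field_differentiable_derivI)
    from DERIV_mirror[THEN iffD1, OF this] show ?thesis .
  qed
  have d: "deriv (\<lambda>t. f (- t)) t = - deriv f (- t)" for t
    using D by (rule DERIV_imp_deriv)
  have "(\<lambda>t. f (- t)) differentiable_on UNIV"
    using D by (auto simp: differentiable_on_def real_differentiable_def)
  moreover have "\<forall>t < - x. deriv (\<lambda>t. f (- t)) t > 0" "\<forall>t > - x. deriv (\<lambda>t. f (- t)) t < 0"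
    using x by (auto simp: d)
  ultimately show ?thesis
    unfolding strictly_unimodal_def by blast
qed

section \<open>The cumulant generating function and its derivatives\<close>

text \<open>The cumulant generating function of a centred Bernoulli variable with parameter
  \<open>p\<close>; the factor \<open>exp (- p * t)\<close> has been taken out of the
  logarithm.\<close>

definition cumulant :: "real \<Rightarrow> real \<Rightarrow> real" where
  "cumulant p t = ln (1 - p + p * exp t) - p * t"

text \<open>The mean of the Bernoulli law after exponential tilting by \<open>t\<close>.\<close>

definition tilt :: "real \<Rightarrow> real \<Rightarrow> real" where
  "tilt p t = p * exp t / (1 - p + p * exp t)"

definition slope_num :: "real \<Rightarrow> real \<Rightarrow> real" where
  "slope_num p t = t * (tilt p t - p) - 2 * cumulant p t"

definition slope_num' :: "real \<Rightarrow> real \<Rightarrow> real" where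
  "slope_num' p t = t * (tilt p t * (1 - tilt p t)) - (tilt p t - p)"

context
  fixes p :: real
  assumes p: "0 < p" "p < 1"
begin

lemma denom_pos: "0 < 1 - p + p * exp t"
  using p by (simp add: add_pos_pos)

lemma g_formula_eq: "g_formula p t = cumulant p t / t\<^sup>2"
proof -
  have "p * exp (t * (1 - p)) + (1 - p) * exp (- t * p) = (1 - p + p * exp t) * exp (- p * t)"
  proof -
    have "exp (t * (1 - p)) = exp t * exp (- p * t)" "exp (- t * p) = exp (- p * t)"
      by (simp_all add: algebra_simps flip: exp_add)
    then show ?thesis by (simp only:) (simp add: algebra_simps)
  qed
  also have "ln \<dots> = cumulant p t"
    using denom_pos[of t] by (simp add: ln_mult cumulant_def)
  finally show ?thesis
    by (simp add: g_formula_def)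
qed

lemma tilt_bounds: "0 < tilt p t" "tilt p t < 1"
  using denom_pos[of t] p by (auto simp: tilt_def)

lemma cumulant_deriv: "(cumulant p has_real_derivative tilt p t - p) (at t)"
  unfolding cumulant_def[abs_def] tilt_def using denom_pos[of t]
  by (auto intro!: derivative_eq_intros)

lemma tilt_deriv: "(tilt p has_real_derivative tilt p t * (1 - tilt p t)) (at t)"
proof -
  define d where "d = 1 - p + p * exp t"
  have "d > 0" using denom_pos by (simp add: d_def)
  have "(tilt p has_real_derivative (p * exp t * d - p * exp t * (p * exp t)) / (d * d)) (at t)"
    unfolding tilt_def[abs_def] d_def using denom_pos[of t]
    by (auto intro!: derivative_eq_intros)
  also have "(p * exp t * d - p * exp t * (p * exp t)) / (d * d) = tilt p t * (1 - tilt p t)"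
    using \<open>d > 0\<close> unfolding tilt_def d_def[symmetric] by (simp add: field_simps)
  finally show ?thesis .
qed

lemma cumulant_0: "cumulant p 0 = 0"
  by (simp add: cumulant_def)

lemma tilt_0: "tilt p 0 = p"
  by (simp add: tilt_def)

section \<open>Value and derivative of \<open>g p\<close>, including the point
  \<open>0\<close>\<close>

lemma g_formula_tendsto: "(g_formula p \<longlongrightarrow> p * (1 - p) / 2) (at 0)"
proof -
  have "((\<lambda>t. (tilt p t - p) / (2 * t)) \<longlongrightarrow> p * (1 - p) / 2) (at 0)"
    \<comment> \<open>This is half the difference quotient of \<open>tilt p\<close> at
      \<open>0\<close>.\<close>
    using tilt_deriv[of 0, unfolded has_field_derivative_iff, THEN tendsto_divide[OF _ tendsto_const[of 2]]]
    by (simp add: tilt_0 mult.commute)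
  then have "((\<lambda>t. cumulant p t / t\<^sup>2) \<longlongrightarrow> p * (1 - p) / 2) (at 0)"
    by (rule lhopital_at_0_real[where g' = "\<lambda>t. 2 * t" and f' = "\<lambda>t. tilt p t - p", rotated -1])
       (auto intro!: derivative_eq_intros cumulant_deriv simp: cumulant_0)
  then show ?thesis
    unfolding g_formula_eq[abs_def] .
qed

lemma g_at_0: "g p 0 = p * (1 - p) / 2"
  using tendsto_Lim[OF _ g_formula_tendsto] by (simp add: g_def)

lemma g_nonzero: "t \<noteq> 0 \<Longrightarrow> g p t = cumulant p t / t\<^sup>2"
  by (simp add: g_def g_formula_eq)

lemma slope_num_deriv: "(slope_num p has_real_derivative slope_num' p t) (at t)"
  unfolding slope_num_def[abs_def] slope_num'_def
  by (auto intro!: derivative_eq_intros cumulant_deriv tilt_deriv simp: algebra_simps)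

lemma slope_num'_deriv:
  "(slope_num' p has_real_derivative t * tilt p t * (1 - tilt p t) * (1 - 2 * tilt p t)) (at t)"
  unfolding slope_num'_def[abs_def]
  by (auto intro!: derivative_eq_intros tilt_deriv simp: algebra_simps)

lemma slope_num_0: "slope_num p 0 = 0" "slope_num' p 0 = 0"
  by (simp_all add: slope_num_def slope_num'_def cumulant_def tilt_def)

lemma g_deriv:
  assumes "t \<noteq> 0"
  shows "(g p has_real_derivative slope_num p t / t ^ 3) (at t)"
proof -
  have "((\<lambda>t. cumulant p t / t\<^sup>2) has_real_derivative slope_num p t / t ^ 3) (at t)"
    using assms by (auto intro!: derivative_eq_intros cumulant_deriv
        simp: slope_num_def field_simps power2_eq_square power3_eq_cube)
  moreover have "eventually (\<lambda>t. cumulant p t / t\<^sup>2 = g p t) (nhds t)"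
    using t1_space_nhds[OF assms] by eventually_elim (simp add: g_nonzero)
  ultimately show ?thesis
    using assms by (simp add: DERIV_cong_ev[OF refl _ refl])
qed

text \<open>The value is the cubic Taylor coefficient of \<open>cumulant p\<close>. Two uses of
  l'Hopital's rule reduce the cubic remainder quotient to a difference quotient of the variance
  \<open>tilt p t * (1 - tilt p t)\<close> at \<open>0\<close>.\<close>

lemma g_deriv_0: "(g p has_real_derivative p * (1 - p) * (1 - 2 * p) / 6) (at 0)"
proof -
  have "((\<lambda>t. (cumulant p t / t\<^sup>2 - p * (1 - p) / 2) / t) \<longlongrightarrow> p * (1 - p) * (1 - 2 * p) / 6) (at 0)"
  proof (rule Lim_transform_eventually)
    define v where "v = p * (1 - p)"
    have "((\<lambda>t. tilt p t * (1 - tilt p t)) has_real_derivative v * (1 - 2 * p)) (at 0)"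
      by (auto intro!: derivative_eq_intros tilt_deriv simp: tilt_0 v_def algebra_simps)
    then have "((\<lambda>t. (tilt p t * (1 - tilt p t) - v) / t / 6) \<longlongrightarrow> v * (1 - 2 * p) / 6) (at 0)"
      unfolding has_field_derivative_iff
      by (intro tendsto_divide tendsto_const) (simp_all add: tilt_0 v_def)
    then have "((\<lambda>t. (tilt p t * (1 - tilt p t) - v) / (6 * t)) \<longlongrightarrow> v * (1 - 2 * p) / 6) (at 0)"
      by (simp add: mult.commute)
    then have "((\<lambda>t. (tilt p t - p - v * t) / (3 * t\<^sup>2)) \<longlongrightarrow> v * (1 - 2 * p) / 6) (at 0)"
      by (rule lhopital_at_0_real[where g' = "\<lambda>t. 6 * t" and f' = "\<lambda>t. tilt p t * (1 - tilt p t) - v", rotated -1])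
         (auto intro!: derivative_eq_intros tilt_deriv simp: tilt_0)
    then have "((\<lambda>t. (cumulant p t - v * t\<^sup>2 / 2) / t ^ 3) \<longlongrightarrow> v * (1 - 2 * p) / 6) (at 0)"
      by (rule lhopital_at_0_real[where g' = "\<lambda>t. 3 * t\<^sup>2" and f' = "\<lambda>t. tilt p t - p - v * t", rotated -1])
         (auto intro!: derivative_eq_intros cumulant_deriv simp: cumulant_0)
    then show "((\<lambda>t. (cumulant p t - p * (1 - p) * t\<^sup>2 / 2) / t ^ 3)
        \<longlongrightarrow> p * (1 - p) * (1 - 2 * p) / 6) (at 0)"
      by (simp add: v_def)
    show "\<forall>\<^sub>F t in at 0. (cumulant p t - p * (1 - p) * t\<^sup>2 / 2) / t ^ 3 =
        (cumulant p t / t\<^sup>2 - p * (1 - p) / 2) / t"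
      unfolding eventually_at_filter
      by (simp add: field_simps power2_eq_square power3_eq_cube)
  qed
  moreover have "eventually (\<lambda>t. (cumulant p t / t\<^sup>2 - p * (1 - p) / 2) / t = (g p t - g p 0) / (t - 0))
      (at 0)"
    unfolding eventually_at_filter by (simp add: g_nonzero g_at_0)
  ultimately show ?thesis
    unfolding has_field_derivative_iff by (simp add: tendsto_cong)
qed

section \<open>Signs of \<open>slope_num\<close> and \<open>slope_num'\<close>\<close>

lemma tilt_less_half_iff: "tilt p t < 1 / 2 \<longleftrightarrow> t < ln ((1 - p) / p)"
proof -
  have "t < ln ((1 - p) / p) \<longleftrightarrow> exp t < (1 - p) / p"
    using p by (metis exp_less_cancel_iff exp_ln diff_gt_0_iff_gt divide_pos_pos)
  then show ?thesis
    using denom_pos[of t] p by (auto simp: tilt_def field_simps)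
qed

lemma tilt_greater_half_iff: "1 / 2 < tilt p t \<longleftrightarrow> ln ((1 - p) / p) < t"
proof -
  have "ln ((1 - p) / p) < t \<longleftrightarrow> (1 - p) / p < exp t"
    using p by (metis exp_less_cancel_iff exp_ln diff_gt_0_iff_gt divide_pos_pos)
  then show ?thesis
    using denom_pos[of t] p by (auto simp: tilt_def field_simps)
qed

text \<open>At \<open>2 * c\<close> the tilted mean has moved from \<open>p\<close> to its mirror
  image \<open>1 - p\<close>, and the cumulant equals \<open>c * (1 - 2 * p)\<close>, so the two
  terms of \<open>slope_num\<close> cancel.\<close>

lemma slope_num_mode: "slope_num p (2 * ln ((1 - p) / p)) = 0"
proof -
  define c where "c = ln ((1 - p) / p)"
  have "exp (2 * c) = ((1 - p) / p)\<^sup>2"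
    using p by (simp add: c_def exp_double)
  then have eq: "p * exp (2 * c) = (1 - p) * ((1 - p) / p)"
    and denom: "1 - p + p * exp (2 * c) = (1 - p) / p"
    using p by (auto simp: field_simps power2_eq_square)
  have "tilt p (2 * c) = 1 - p"
    unfolding tilt_def denom unfolding eq using p by simp
  moreover have "cumulant p (2 * c) = c - p * (2 * c)"
    unfolding cumulant_def denom by (simp add: c_def)
  ultimately have "slope_num p (2 * c) = 0"
    unfolding slope_num_def by (simp only:) (simp add: algebra_simps)
  then show ?thesis by (simp add: c_def)
qed

lemma continuous_on_slope_num:
  "continuous_on A (slope_num p)" "continuous_on A (slope_num' p)"
  using slope_num_deriv slope_num'_deriv
  by (auto intro!: continuous_at_imp_continuous_on intro: DERIV_isCont)

lemma slope_num'_antimono_right: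
  assumes "0 \<le> u" "ln ((1 - p) / p) \<le> u" "u < v"
  shows "slope_num' p v < slope_num' p u"
proof (rule DERIV_neg_imp_decreasing_open[OF \<open>u < v\<close> _ continuous_on_slope_num(2)])
  fix t assume "u < t" "t < v"
  then have "0 < t" "1 / 2 < tilt p t"
    using assms tilt_greater_half_iff[of t] by linarith+
  then have "t * tilt p t * (1 - tilt p t) * (1 - 2 * tilt p t) < 0"
    using tilt_bounds[of t] by (intro mult_pos_neg mult_pos_pos) auto
  then show "\<exists>y. (slope_num' p has_real_derivative y) (at t) \<and> y < 0"
    using slope_num'_deriv by blast
qed

lemma slope_num'_pos:
  assumes "0 < t" "t \<le> ln ((1 - p) / p)"
  shows "0 < slope_num' p t"
proof -
  have "slope_num' p 0 < slope_num' p t"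
  \<comment> \<open>The sign is checked on the open interval only, as the second derivative vanishes
    at \<open>0\<close> and, if \<open>t\<close> is the right end of the allowed range, at
    \<open>t\<close> too.\<close>
  proof (rule DERIV_pos_imp_increasing_open[OF \<open>0 < t\<close> _ continuous_on_slope_num(2)])
    fix s assume "0 < s" "s < t"
    moreover from this have "tilt p s < 1 / 2"
      using assms tilt_less_half_iff[of s] by linarith
    ultimately have "s * tilt p s * (1 - tilt p s) * (1 - 2 * tilt p s) > 0"
      using tilt_bounds[of s] by (intro mult_pos_pos) auto
    then show "\<exists>y. (slope_num' p has_real_derivative y) (at s) \<and> y > 0"
      using slope_num'_deriv by blast
  qed
  then show ?thesis by (simp add: slope_num_0)
qed

lemma slope_num_pos:
  assumes "0 < t" "t \<le> ln ((1 - p) / p)"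
  shows "0 < slope_num p t"
proof -
  have "slope_num p 0 < slope_num p t"
    using assms slope_num_deriv slope_num'_pos
    by (intro DERIV_pos_imp_increasing_open[OF _ _ continuous_on_slope_num(1)])
       (auto intro!: exI)
  then show ?thesis by (simp add: slope_num_0)
qed

text \<open>Left of \<open>0\<close> the tilted mean is still below 1/2, but the factor
  \<open>s\<close> of the second derivative is negative, so \<open>slope_num'\<close> decreases to
  its value 0 at the origin.\<close>

lemma slope_num'_pos_left:
  assumes "t < 0" "0 \<le> ln ((1 - p) / p)"
  shows "0 < slope_num' p t"
proof -
  have "slope_num' p 0 < slope_num' p t"
  proof (rule DERIV_neg_imp_decreasing_open[OF \<open>t < 0\<close> _ continuous_on_slope_num(2)])
    fix s :: real assume "t < s" "s < 0"
    moreover from this have "tilt p s < 1 / 2"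
      using assms tilt_less_half_iff[of s] by linarith
    ultimately have "s * (tilt p s * (1 - tilt p s) * (1 - 2 * tilt p s)) < 0"
      using tilt_bounds[of s] by (intro mult_neg_pos mult_pos_pos) auto
    then show "\<exists>y. (slope_num' p has_real_derivative y) (at s) \<and> y < 0"
      using slope_num'_deriv by (auto simp: mult.assoc)
  qed
  then show ?thesis by (simp add: slope_num_0)
qed

lemma slope_num_neg_left:
  assumes "t < 0" "0 \<le> ln ((1 - p) / p)"
  shows "slope_num p t < 0"
proof -
  have "slope_num p t < slope_num p 0"
    using assms slope_num_deriv slope_num'_pos_left
    by (intro DERIV_pos_imp_increasing_open[OF _ _ continuous_on_slope_num(1)])
       (auto intro!: exI)
  then show ?thesis by (simp add: slope_num_0)
qed

lemma slope_num_pos_before_mode: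
  assumes "0 < t" "t < 2 * ln ((1 - p) / p)"
  shows "0 < slope_num p t"
proof (cases "t \<le> ln ((1 - p) / p)")
  case True
  then show ?thesis using assms slope_num_pos by blast
next
  case False
  define c where "c = ln ((1 - p) / p)"
  have "0 < c" using assms by (simp add: c_def)
  show ?thesis
  \<comment> \<open>Taken with \<open>c\<close> and \<open>2 * c\<close> as endpoints: the concave
    range starts at \<open>c\<close>, where \<open>slope_num\<close> is already positive.\<close>
  proof (rule strict_antimono_deriv_sign(1)[OF slope_num_deriv])
    show "slope_num' p v < slope_num' p u" if "c \<le> u" "u < v" for u v
      using that \<open>0 < c\<close> by (intro slope_num'_antimono_right) (simp_all add: c_def)
    show "0 < slope_num p c" "slope_num p (2 * c) = 0"
      using \<open>0 < c\<close> slope_num_pos slope_num_mode by (simp_all add: c_def)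
  qed (use False \<open>0 < c\<close> assms in \<open>simp_all add: c_def\<close>)
qed

lemma slope_num_neg_after_mode:
  assumes "0 \<le> ln ((1 - p) / p)" "2 * ln ((1 - p) / p) < t"
  shows "slope_num p t < 0"
proof (cases "ln ((1 - p) / p) = 0")
  \<comment> \<open>Here \<open>p\<close> is 1/2 and the mode is \<open>0\<close>, so there is no
    positive starting value; instead \<open>slope_num'\<close> is negative immediately to the right
    of \<open>0\<close>.\<close>
  case True
  have neg: "slope_num' p s < 0" if "0 < s" for s
    using slope_num'_antimono_right[of 0 s] True that by (simp add: slope_num_0)
  have "slope_num p t < slope_num p 0"
    using assms True slope_num_deriv neg
    by (intro DERIV_neg_imp_decreasing_open[OF _ _ continuous_on_slope_num(1)])
       (auto intro!: exI)
  then show ?thesis by (simp add: slope_num_0)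
next
  case False
  define c where "c = ln ((1 - p) / p)"
  have "0 < c" using assms False by (simp add: c_def)
  show ?thesis
  proof (rule strict_antimono_deriv_sign(2)[OF slope_num_deriv])
    show "slope_num' p v < slope_num' p u" if "c \<le> u" "u < v" for u v
      using that \<open>0 < c\<close> by (intro slope_num'_antimono_right) (simp_all add: c_def)
    show "0 < slope_num p c" "slope_num p (2 * c) = 0"
      using \<open>0 < c\<close> slope_num_pos slope_num_mode by (simp_all add: c_def)
  qed (use \<open>0 < c\<close> assms in \<open>simp_all add: c_def\<close>)
qed

section \<open>Unimodality for \<open>p\<close> up to 1/2, and the extension by symmetry\<close>

lemma strictly_unimodal_g_le_half:
  assumes "p \<le> 1 / 2"
  shows "strictly_unimodal (g p)"
proof -
  define x where "x = 2 * ln ((1 - p) / p)"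
  have x: "0 \<le> ln ((1 - p) / p)"
    using p assms by (simp add: field_simps)
  have d: "deriv (g p) t = slope_num p t / t ^ 3" if "t \<noteq> 0" for t
    using g_deriv[OF that] by (rule DERIV_imp_deriv)
  have d0: "deriv (g p) 0 = p * (1 - p) * (1 - 2 * p) / 6"
    using g_deriv_0 by (rule DERIV_imp_deriv)
  have "g p differentiable at t" for t
    using g_deriv g_deriv_0 by (cases "t = 0") (auto simp: real_differentiable_def)
  then have "g p differentiable_on UNIV"
    by (simp add: differentiable_on_def)
  moreover have "deriv (g p) t > 0" if "t < x" for t
  proof (cases t "0 :: real" rule: linorder_cases)
    case less
    then show ?thesis
      using slope_num_neg_left[OF less x] by (simp add: d divide_neg_neg)
  next
    \<comment> \<open>For \<open>p\<close> equal to 1/2 the derivative at \<open>0\<close> vanishes,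
      but then \<open>x\<close> is \<open>0\<close> and \<open>t < x\<close> excludes this
      case.\<close>
    case equal
    have "p \<noteq> 1 / 2" using that equal by (auto simp: x_def)
    then show ?thesis using p assms equal by (simp add: d0)
  next
    case greater
    then show ?thesis
      using that slope_num_pos_before_mode[of t] by (simp add: d x_def)
  qed
  moreover have "deriv (g p) t < 0" if "t > x" for t
  proof -
    have "0 < t" using that x by (simp add: x_def)
    then show ?thesis
      using that slope_num_neg_after_mode[of t] x by (simp add: d x_def divide_neg_pos)
  qed
  ultimately show ?thesis
    unfolding strictly_unimodal_def by blast
qed

end

text \<open>The substitution swaps the two summands inside the logarithm, and the limit
  \<open>p * (1 - p) / 2\<close> at \<open>0\<close> is symmetric in \<open>p\<close> and
  \<open>1 - p\<close>.\<close>

lemma g_reflect: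
  assumes "0 < p" "p < 1"
  shows "g p t = g (1 - p) (- t)"
proof (cases "t = 0")
  case True
  then show ?thesis using assms by (simp add: g_at_0)
next
  case False
  then show ?thesis by (simp add: g_def g_formula_def add.commute)
qed

theorem theorem1p1:
  fixes p :: real
  assumes "0 < p" and "p < 1"
  shows "strictly_unimodal (g p)"
proof (cases "p \<le> 1 / 2")
  case True
  then show ?thesis using assms by (intro strictly_unimodal_g_le_half)
next
  case False
  then have "strictly_unimodal (g (1 - p))"
    using assms by (intro strictly_unimodal_g_le_half) auto
  then have "strictly_unimodal (\<lambda>t. g (1 - p) (- t))"
    by (rule strictly_unimodal_reflect)
  then show ?thesis
    by (simp flip: g_reflect[OF assms])
qed

end
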